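(* Let $\{\varphi_i\}_{i\in I}$ be a frame for a Hilbert space $\mathbb{H}$ with frame bounds $A,B$ and let $T:\mathbb{H}\to\mathbb{H}$ be a bounded linear operator. If $\|Id-T\|^2<\frac{A}{B}$, then $\{\varphi_i\}_{i\in I}$ and $\{T\varphi_i\}_{i\in I}$ are woven.
   Context: $I$ is a finite or countably infinite index set, $Id$ is the identity operator on $\mathbb{H}$, and the norm of an operator is the operator norm. A family $\{f_i\}_{i\in J}$ in $\mathbb{H}$ is a frame for $\mathbb H$ with (lower, upper) frame bounds $A,B$ if $0<A\le B<\infty$ and $A\|x\|^2\le \sum_{i\in J}|\langle x,f_i\rangle|^2\le B\|x\|^2$ for all $x\in\mathbb{H}$. Two frames $\{\varphi_i\}_{i\in I}$, $\{\psi_i\}_{i\in I}$ for $\mathbb{H}$ are woven if there are universal constants $0<A'\le B'<\infty$ such that for every $\sigma\subset I$ (with $\sigma^c=I\setminus\sigma$) the indexed family $\{\varphi_i\}_{i\in\sigma}\cup\{\psi_i\}_{i\in\sigma^c}$ is a frame for $\mathbb{H}$ with lower and upper frame bounds $A'$ and $B'$. *)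

theory Defs
  imports "HOL-Analysis.Analysis"
begin

text \<open>
  The scalar field of a Hilbert space is the reals or the complex numbers. Both cases are covered
  by one class; by the Gelfand--Mazur theorem it has no instances other than these two, up to
  isomorphism. The conjugation is determined by the last axiom.
\<close>

class hilbert_scalar = real_normed_field +
  fixes conjugate :: "'a \<Rightarrow> 'a"
  assumes conjugate_add: "conjugate (x + y) = conjugate x + conjugate y"
    and conjugate_mult: "conjugate (x * y) = conjugate x * conjugate y"
    and mult_conjugate: "x * conjugate x = (norm x)\<^sup>2 *\<^sub>R 1"

instantiation real :: hilbert_scalar
begin

definition conjugate_real :: "real \<Rightarrow> real"
  where "conjugate_real x = x"

instance
  by standard (simp_all add: conjugate_real_def power2_eq_square)

end

instantiation complex :: hilbert_scalar
begin

definition conjugate_complex :: "complex \<Rightarrow> complex"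
  where "conjugate_complex = cnj"

instance
  by standard (simp_all add: conjugate_complex_def scaleR_conv_of_real complex_norm_square[symmetric]
      del: of_real_power)

end

text \<open>
  A Hilbert space over \<open>'k\<close>: the class \<^class>\<open>banach\<close> supplies the norm and completeness, and the
  axioms say that the norm is the one induced by the inner product \<open>ip\<close>, which is linear in its
  first argument, and that the real scalar multiplication of the class is the restriction of
  \<open>scale\<close>.
\<close>

locale hilbert_space = vector_space scale
  for scale :: "'k::hilbert_scalar \<Rightarrow> 'h::banach \<Rightarrow> 'h" +
  fixes ip :: "'h \<Rightarrow> 'h \<Rightarrow> 'k"
  assumes scale_of_real: "scale (of_real r) x = r *\<^sub>R x"
    and ip_add_left: "ip (x + y) z = ip x z + ip y z"
    and ip_scale_left: "ip (scale c x) y = c * ip x y"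
    and ip_conjugate: "ip y x = conjugate (ip x y)"
    and ip_self: "ip x x = of_real ((norm x)\<^sup>2)"

lemma hilbert_space_real:
  "hilbert_space (scaleR :: real \<Rightarrow> 'h \<Rightarrow> 'h :: {real_inner, banach}) inner"
  by unfold_locales
    (simp_all add: algebra_simps inner_commute conjugate_real_def power2_norm_eq_inner)

lemma hilbert_space_complex:
  "hilbert_space ((*) :: complex \<Rightarrow> complex \<Rightarrow> complex) (\<lambda>x y. x * cnj y)"
  by unfold_locales
    (simp_all add: algebra_simps conjugate_complex_def scaleR_conv_of_real
      complex_norm_square[symmetric])

text \<open>Summability is explicit because \<^const>\<open>infsum\<close> is \<open>0\<close> on families that are not summable.\<close>

definition frame_with_bounds ::
  "('h::real_normed_vector \<Rightarrow> 'h \<Rightarrow> 'k::real_normed_vector) \<Rightarrow>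
    'i set \<Rightarrow> ('i \<Rightarrow> 'h) \<Rightarrow> real \<Rightarrow> real \<Rightarrow> bool"
  where
  "frame_with_bounds ip J f A B \<longleftrightarrow>
     0 < A \<and> A \<le> B \<and>
     (\<forall>x. (\<lambda>i. (norm (ip x (f i)))\<^sup>2) summable_on J \<and>
          A * (norm x)\<^sup>2 \<le> (\<Sum>\<^sub>\<infinity>i\<in>J. (norm (ip x (f i)))\<^sup>2) \<and>
          (\<Sum>\<^sub>\<infinity>i\<in>J. (norm (ip x (f i)))\<^sup>2) \<le> B * (norm x)\<^sup>2)"

definition is_frame ::
  "('h::real_normed_vector \<Rightarrow> 'h \<Rightarrow> 'k::real_normed_vector) \<Rightarrow>
    'i set \<Rightarrow> ('i \<Rightarrow> 'h) \<Rightarrow> bool"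
  where "is_frame ip J f \<longleftrightarrow> (\<exists>A B. frame_with_bounds ip J f A B)"

text \<open>
  The family \<open>{\<phi>\<^sub>i}\<^bsub>i\<in>\<sigma>\<^esub> \<union> {\<psi>\<^sub>i}\<^bsub>i\<in>I-\<sigma>\<^esub>\<close> is an indexed family, so vectors
  occurring for several indices are counted with multiplicity.
\<close>

definition woven ::
  "('h::real_normed_vector \<Rightarrow> 'h \<Rightarrow> 'k::real_normed_vector) \<Rightarrow>
    'i set \<Rightarrow> ('i \<Rightarrow> 'h) \<Rightarrow> ('i \<Rightarrow> 'h) \<Rightarrow> bool"
  where
  "woven ip I \<phi> \<psi> \<longleftrightarrow>
     is_frame ip I \<phi> \<and> is_frame ip I \<psi> \<and>
     (\<exists>A' B'. \<forall>\<sigma>. \<sigma> \<subseteq> I \<longrightarrow>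
        frame_with_bounds ip I (\<lambda>i. if i \<in> \<sigma> then \<phi> i else \<psi> i) A' B')"

end

theory Submission
  imports Defs
begin

text \<open>
  Write \<open>S = Id - T\<close> and \<open>q\<close> for its operator norm. For \<open>\<sigma> \<subseteq> I\<close> the woven family differs from
  \<open>\<phi>\<close> by \<open>0\<close> on \<open>\<sigma>\<close> and by \<open>- S \<phi>\<^sub>i\<close> off \<open>\<sigma>\<close>. A bounded operator maps a Bessel family with bound
  \<open>B\<close> to one with bound \<open>q\<^sup>2 B\<close> (lemma \<open>bessel_image\<close>), so the differences are a Bessel family with
  bound \<open>q\<^sup>2 B\<close>, whatever \<open>\<sigma>\<close> is. Since \<open>q\<^sup>2 < A / B\<close> says that \<open>q \<surd>B < \<surd>A\<close>, Minkowski's inequality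
  for the sequences of frame coefficients gives
  \<open>(\<surd>A - q \<surd>B) \<parallel>x\<parallel> \<le> (\<Sum>\<bar>\<langle>x, f\<^sub>i\<rangle>\<bar>\<^sup>2)\<^bsup>1/2\<^esup> \<le> (\<surd>B + q \<surd>B) \<parallel>x\<parallel>\<close>
  for the woven family \<open>f\<close> (lemma \<open>frame_perturbation\<close>), and these bounds do not depend on \<open>\<sigma>\<close>.

  The usual proof that images of Bessel families are Bessel uses the adjoint of \<open>S\<close>. Here it is
  replaced by duality on finite sections: the synthesis operator
  \<open>c \<mapsto> \<Sum>c\<^sub>i \<phi>\<^sub>i\<close> is bounded by \<open>\<surd>B\<close>, and testing \<open>S (\<Sum>c\<^sub>i \<phi>\<^sub>i)\<close> against \<open>x\<close> with
  \<open>c\<^sub>i = \<langle>x, S \<phi>\<^sub>i\<rangle>\<close> recovers \<open>\<Sum>\<bar>c\<^sub>i\<bar>\<^sup>2\<close>.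
\<close>

lemma conjugate_0 [simp]: "conjugate (0 :: 'k::hilbert_scalar) = 0"
  using conjugate_add[of "0 :: 'k" 0] by simp

lemma mult_conjugate_of_real: "x * conjugate x = of_real ((norm x)\<^sup>2)"
  for x :: "'k::hilbert_scalar"
  by (simp only: mult_conjugate of_real_def)

lemma norm_conjugate [simp]: "norm (conjugate x) = norm x" for x :: "'k::hilbert_scalar"
proof (cases "x = 0")
  case False
  have "norm x * norm (conjugate x) = norm (of_real ((norm x)\<^sup>2) :: 'k)"
    by (simp only: mult_conjugate_of_real flip: norm_mult)
  also have "\<dots> = norm x * norm x"
    by (simp only: norm_of_real) (simp add: power2_eq_square)
  finally show ?thesis
    using False by simp
qed simp

context hilbert_space
begin

lemma ip_add_right: "ip x (y + z) = ip x y + ip x z"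
  by (metis ip_add_left ip_conjugate conjugate_add)

lemma ip_scale_right: "ip x (scale c y) = conjugate c * ip x y"
  by (metis ip_scale_left ip_conjugate conjugate_mult)

lemma ip_zero_right [simp]: "ip x 0 = 0"
  using ip_add_right[of x 0 0] by simp

lemma ip_zero_left [simp]: "ip 0 x = 0"
  using ip_add_left[of 0 0 x] by simp

lemma ip_minus_right: "ip x (- y) = - ip x y"
  using ip_add_right[of x y "- y"] by (simp add: eq_neg_iff_add_eq_0 add.commute)

lemma ip_sum_right: "ip x (\<Sum>i\<in>F. f i) = (\<Sum>i\<in>F. ip x (f i))"
  by (induction F rule: infinite_finite_induct) (simp_all add: ip_add_right)

lemma cauchy_schwarz: "norm (ip x y) \<le> norm x * norm y"
proof (cases "y = 0")
  case False
  then have y: "ip y y \<noteq> 0"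
    by (simp add: ip_self)
  \<comment> \<open>the component of \<open>x\<close> orthogonal to \<open>y\<close>\<close>
  define c where "c = ip x y / ip y y"
  define v where "v = x - scale c y"
  have x: "x = v + scale c y"
    by (simp add: v_def)
  have "ip x y = ip v y + c * ip y y"
    by (subst x) (simp add: ip_add_left ip_scale_left)
  then have "ip v y = 0"
    using y by (simp add: c_def)
  then have "ip v x = ip v v"
    by (subst x) (simp add: ip_add_right ip_scale_right)
  then have "ip x x = ip v v + c * ip y x"
    by (metis x ip_add_left ip_scale_left)
  also have "c * ip y x = of_real ((norm (ip x y))\<^sup>2) / of_real ((norm y)\<^sup>2)"
    unfolding c_def ip_self[of y]
    by (simp only: times_divide_eq_left ip_conjugate[of y x] mult_conjugate_of_real)
  finally have "(of_real ((norm x)\<^sup>2) :: 'k)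
      = of_real ((norm v)\<^sup>2 + (norm (ip x y))\<^sup>2 / (norm y)\<^sup>2)"
    by (simp only: ip_self of_real_add of_real_divide)
  then have "(norm x)\<^sup>2 = (norm v)\<^sup>2 + (norm (ip x y))\<^sup>2 / (norm y)\<^sup>2"
    by (simp only: of_real_eq_iff)
  then have "(norm (ip x y))\<^sup>2 / (norm y)\<^sup>2 \<le> (norm x)\<^sup>2"
    by simp
  then have "(norm (ip x y))\<^sup>2 \<le> (norm x * norm y)\<^sup>2"
    using False by (simp add: power_mult_distrib divide_le_eq)
  then show ?thesis
    by (rule power2_le_imp_le) simp
qed simp

text \<open>
  The synthesis operator is the adjoint of the analysis operator \<open>v \<mapsto> (\<langle>v, f\<^sub>i\<rangle>)\<^sub>i\<close>, so it has
  the same norm: pair the synthesized vector with itself.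
\<close>

lemma bessel_synthesis_bound:
  assumes bessel: "\<And>v. (\<Sum>i\<in>F. (norm (ip v (f i)))\<^sup>2) \<le> (b * norm v)\<^sup>2" and "0 \<le> b"
  shows "norm (\<Sum>i\<in>F. scale (c i) (f i)) \<le> b * L2_set (\<lambda>i. norm (c i)) F"
proof -
  define v where "v = (\<Sum>i\<in>F. scale (c i) (f i))"
  have "(norm v)\<^sup>2 = norm (ip v v)"
    by (simp only: ip_self norm_of_real) simp
  also have "ip v v = (\<Sum>i\<in>F. conjugate (c i) * ip v (f i))"
    by (subst (2) v_def) (simp add: ip_sum_right ip_scale_right)
  also have "norm \<dots> \<le> (\<Sum>i\<in>F. \<bar>norm (c i)\<bar> * \<bar>norm (ip v (f i))\<bar>)"
    by (rule order_trans[OF norm_sum]) (simp add: norm_mult)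
  also have "\<dots> \<le> L2_set (\<lambda>i. norm (c i)) F * L2_set (\<lambda>i. norm (ip v (f i))) F"
    by (rule L2_set_mult_ineq)
  also have "\<dots> \<le> L2_set (\<lambda>i. norm (c i)) F * (b * norm v)"
    using \<open>0 \<le> b\<close> unfolding L2_set_def
    by (intro mult_left_mono real_le_lsqrt bessel) (simp_all add: sum_nonneg)
  finally have "norm v * norm v \<le> (b * L2_set (\<lambda>i. norm (c i)) F) * norm v"
    by (simp add: power2_eq_square mult_ac)
  then have "norm v \<le> b * L2_set (\<lambda>i. norm (c i)) F"
    using \<open>0 \<le> b\<close> by (cases "v = 0") simp_all
  then show ?thesis
    by (simp only: v_def)
qed

text \<open>
  For \<open>c\<^sub>i = \<langle>x, S f\<^sub>i\<rangle>\<close> linearity gives \<open>\<langle>x, S (\<Sum>c\<^sub>i f\<^sub>i)\<rangle> = \<Sum>\<bar>c\<^sub>i\<bar>\<^sup>2\<close>, while Cauchy--Schwarz and the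
  bound on synthesis give at most \<open>\<parallel>x\<parallel> q b (\<Sum>\<bar>c\<^sub>i\<bar>\<^sup>2)\<^bsup>1/2\<^esup>\<close>; cancel a square root.
\<close>

lemma bessel_image:
  assumes bessel: "\<And>v. (\<Sum>i\<in>F. (norm (ip v (f i)))\<^sup>2) \<le> (b * norm v)\<^sup>2" and "0 \<le> b"
    and S: "Vector_Spaces.linear scale scale S" and bound: "\<And>v. norm (S v) \<le> q * norm v"
    and "0 \<le> q"
  shows "L2_set (\<lambda>i. norm (ip x (S (f i)))) F \<le> q * b * norm x"
proof -
  interpret S: Vector_Spaces.linear scale scale S
    by (rule S)
  define c where "c = (\<lambda>i. ip x (S (f i)))"
  define v where "v = (\<Sum>i\<in>F. scale (c i) (f i))"
  define s where "s = L2_set (\<lambda>i. norm (c i)) F"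
  have s2: "s\<^sup>2 = (\<Sum>i\<in>F. (norm (c i))\<^sup>2)"
    by (simp add: s_def L2_set_def sum_nonneg)
  have "ip x (S v) = (\<Sum>i\<in>F. conjugate (c i) * c i)"
    by (simp add: v_def S.sum S.scale ip_sum_right ip_scale_right c_def)
  also have "\<dots> = of_real (s\<^sup>2)"
    unfolding s2 of_real_sum
    by (rule sum.cong[OF refl]) (simp only: mult.commute[of "conjugate _"] mult_conjugate_of_real)
  finally have "s\<^sup>2 = norm (ip x (S v))"
    by (simp only: norm_of_real) simp
  also have "\<dots> \<le> norm x * norm (S v)"
    by (rule cauchy_schwarz)
  also have "\<dots> \<le> norm x * (q * norm v)"
    by (intro mult_left_mono bound) simp
  also have "\<dots> \<le> norm x * (q * (b * s))"
    using bessel_synthesis_bound[OF bessel \<open>0 \<le> b\<close>, of c] \<open>0 \<le> q\<close>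
    by (intro mult_left_mono) (simp_all add: v_def s_def)
  finally have "s * s \<le> (q * b * norm x) * s"
    by (simp add: power2_eq_square mult_ac)
  moreover have "0 \<le> s"
    by (simp add: s_def L2_set_nonneg)
  ultimately have "s \<le> q * b * norm x"
    using \<open>0 \<le> b\<close> \<open>0 \<le> q\<close> by (cases "s = 0") (simp_all add: mult_le_cancel_right)
  then show ?thesis
    by (simp only: s_def c_def)
qed

text \<open>
  Minkowski's inequality compares the coefficient sequences of \<open>f\<close> and \<open>g\<close> on every finite index
  set, in both directions, with error at most \<open>r \<parallel>x\<parallel>\<close>; one direction bounds the partial sums of
  \<open>g\<close>, and the other bounds those of \<open>f\<close> in terms of the full sum for \<open>g\<close>.
\<close>

lemma frame_perturbation:
  assumes frame: "frame_with_bounds ip J f A B"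
    and close: "\<And>F x. finite F \<Longrightarrow> F \<subseteq> J \<Longrightarrow> L2_set (\<lambda>i. norm (ip x (g i - f i))) F \<le> r * norm x"
    and "0 \<le> r" "r < sqrt A"
  shows "frame_with_bounds ip J g ((sqrt A - r)\<^sup>2) ((sqrt B + r)\<^sup>2)"
proof -
  from frame have AB: "0 < A" "A \<le> B"
    by (auto simp: frame_with_bounds_def)
  have summ: "(\<lambda>i. (norm (ip x (f i)))\<^sup>2) summable_on J"
    and lower: "A * (norm x)\<^sup>2 \<le> (\<Sum>\<^sub>\<infinity>i\<in>J. (norm (ip x (f i)))\<^sup>2)"
    and upper: "(\<Sum>\<^sub>\<infinity>i\<in>J. (norm (ip x (f i)))\<^sup>2) \<le> B * (norm x)\<^sup>2" for x
    using frame by (auto simp: frame_with_bounds_def)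
  have diff: "ip x (g i) = ip x (f i) + ip x (g i - f i)" for x i
    using ip_add_right[of x "f i" "g i - f i"] by simp
  have partial_g: "(\<Sum>i\<in>F. (norm (ip x (g i)))\<^sup>2) \<le> (sqrt B + r)\<^sup>2 * (norm x)\<^sup>2"
    if F: "finite F" "F \<subseteq> J" for F x
  proof -
    have "(\<Sum>i\<in>F. (norm (ip x (f i)))\<^sup>2) \<le> B * (norm x)\<^sup>2"
      by (rule order_trans[OF finite_sum_le_infsum[OF summ F] upper]) simp
    then have "L2_set (\<lambda>i. norm (ip x (f i))) F \<le> sqrt B * norm x"
      using AB unfolding L2_set_def
      by (intro real_le_lsqrt) (simp_all add: sum_nonneg power_mult_distrib)
    moreover have "L2_set (\<lambda>i. norm (ip x (g i))) F
        \<le> L2_set (\<lambda>i. norm (ip x (f i)) + norm (ip x (g i - f i))) F"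
      by (intro L2_set_mono) (simp_all add: diff norm_triangle_ineq)
    moreover have "\<dots> \<le> L2_set (\<lambda>i. norm (ip x (f i))) F + L2_set (\<lambda>i. norm (ip x (g i - f i))) F"
      by (rule L2_set_triangle_ineq)
    ultimately have "L2_set (\<lambda>i. norm (ip x (g i))) F \<le> (sqrt B + r) * norm x"
      using close[OF F, of x] by (simp add: distrib_right)
    then show ?thesis
      unfolding L2_set_def power_mult_distrib[symmetric] by (rule sqrt_le_D)
  qed
  have summ_g: "(\<lambda>i. (norm (ip x (g i)))\<^sup>2) summable_on J" for x
    using partial_g by (intro nonneg_bdd_above_summable_on bdd_aboveI2) auto
  have upper_g: "(\<Sum>\<^sub>\<infinity>i\<in>J. (norm (ip x (g i)))\<^sup>2) \<le> (sqrt B + r)\<^sup>2 * (norm x)\<^sup>2" for x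
    by (intro infsum_le_finite_sums summ_g partial_g)
  have lower_g: "(sqrt A - r)\<^sup>2 * (norm x)\<^sup>2 \<le> (\<Sum>\<^sub>\<infinity>i\<in>J. (norm (ip x (g i)))\<^sup>2)" for x
  proof -
    define G where "G = (\<Sum>\<^sub>\<infinity>i\<in>J. (norm (ip x (g i)))\<^sup>2)"
    have "0 \<le> G"
      by (simp add: G_def infsum_nonneg)
    have "(\<Sum>i\<in>F. (norm (ip x (f i)))\<^sup>2) \<le> (sqrt G + r * norm x)\<^sup>2"
      if F: "finite F" "F \<subseteq> J" for F
    proof -
      have "L2_set (\<lambda>i. norm (ip x (g i))) F \<le> sqrt G"
        unfolding L2_set_def G_def
        using finite_sum_le_infsum[OF summ_g F] by simp
      moreover have "L2_set (\<lambda>i. norm (ip x (f i))) F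
          \<le> L2_set (\<lambda>i. norm (ip x (g i)) + norm (ip x (g i - f i))) F"
      proof (intro L2_set_mono)
        show "norm (ip x (f i)) \<le> norm (ip x (g i)) + norm (ip x (g i - f i))" for i
          using norm_triangle_ineq4[of "ip x (g i)" "ip x (g i - f i)"] diff[of x i] by simp
      qed simp
      moreover have "\<dots> \<le> L2_set (\<lambda>i. norm (ip x (g i))) F + L2_set (\<lambda>i. norm (ip x (g i - f i))) F"
        by (rule L2_set_triangle_ineq)
      ultimately have "L2_set (\<lambda>i. norm (ip x (f i))) F \<le> sqrt G + r * norm x"
        using close[OF F, of x] by simp
      then show ?thesis
        unfolding L2_set_def by (rule sqrt_le_D)
    qed
    then have "(\<Sum>\<^sub>\<infinity>i\<in>J. (norm (ip x (f i)))\<^sup>2) \<le> (sqrt G + r * norm x)\<^sup>2"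
      by (intro infsum_le_finite_sums summ)
    with lower have "A * (norm x)\<^sup>2 \<le> (sqrt G + r * norm x)\<^sup>2"
      by (rule order_trans)
    then have "(sqrt A * norm x)\<^sup>2 \<le> (sqrt G + r * norm x)\<^sup>2"
      using AB by (simp add: power_mult_distrib)
    then have "sqrt A * norm x \<le> sqrt G + r * norm x"
      using \<open>0 \<le> G\<close> \<open>0 \<le> r\<close> by - (rule power2_le_imp_le, simp_all)
    then have "((sqrt A - r) * norm x)\<^sup>2 \<le> (sqrt G)\<^sup>2"
      using \<open>r < sqrt A\<close> by (intro power_mono) (simp_all add: left_diff_distrib mult_right_mono)
    then show ?thesis
      using \<open>0 \<le> G\<close> by (simp add: power_mult_distrib G_def)
  qed
  have "sqrt A \<le> sqrt B"
    using AB by simp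
  then have "(sqrt A - r)\<^sup>2 \<le> (sqrt B + r)\<^sup>2"
    using \<open>0 \<le> r\<close> \<open>r < sqrt A\<close> by (intro power_mono; linarith)
  then show ?thesis
    using \<open>r < sqrt A\<close> summ_g upper_g lower_g by (simp add: frame_with_bounds_def)
qed

end

theorem proposition6p2:
  fixes scale :: "'k::hilbert_scalar \<Rightarrow> 'h::banach \<Rightarrow> 'h"
    and ip :: "'h \<Rightarrow> 'h \<Rightarrow> 'k"
    and I :: "'i set"
    and \<phi> :: "'i \<Rightarrow> 'h"
    and A B :: real
    and T :: "'h \<Rightarrow> 'h"
  assumes "hilbert_space scale ip"
    and "countable I"
    and "frame_with_bounds ip I \<phi> A B"
    and "Vector_Spaces.linear scale scale T"
    and "bounded_linear T"
    and "(onorm (\<lambda>x. x - T x))\<^sup>2 < A / B"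
  shows "woven ip I \<phi> (\<lambda>i. T (\<phi> i))"
proof -
  interpret hilbert_space scale ip
    by fact
  interpret T: Vector_Spaces.linear scale scale T
    by fact
  define S where "S = (\<lambda>x. x - T x)"
  define q where "q = onorm S"
  have S_bounded: "bounded_linear S"
    unfolding S_def using assms(5) by (intro bounded_linear_sub bounded_linear_ident)
  have S_linear: "Vector_Spaces.linear scale scale S"
    by unfold_locales (simp_all add: S_def T.add T.scale scale_right_diff_distrib)
  have S_bound: "norm (S v) \<le> q * norm v" for v
    unfolding q_def by (rule onorm[OF S_bounded])
  have q: "0 \<le> q"
    unfolding q_def by (rule onorm_pos_le[OF S_bounded])
  from assms(3) have AB: "0 < A" "A \<le> B"
    by (auto simp: frame_with_bounds_def)
  have bessel: "(\<Sum>i\<in>F. (norm (ip v (\<phi> i)))\<^sup>2) \<le> (sqrt B * norm v)\<^sup>2"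
    if "finite F" "F \<subseteq> I" for F v
  proof -
    have "(\<Sum>i\<in>F. (norm (ip v (\<phi> i)))\<^sup>2) \<le> (\<Sum>\<^sub>\<infinity>i\<in>I. (norm (ip v (\<phi> i)))\<^sup>2)"
      using assms(3) that by (intro finite_sum_le_infsum) (auto simp: frame_with_bounds_def)
    also have "\<dots> \<le> B * (norm v)\<^sup>2"
      using assms(3) by (auto simp: frame_with_bounds_def)
    finally show ?thesis
      using AB by (simp add: power_mult_distrib)
  qed
  have "q\<^sup>2 * B < A"
    using assms(6) AB by (simp add: q_def S_def less_divide_eq)
  then have small: "q * sqrt B < sqrt A"
    using AB by (intro real_less_rsqrt) (simp add: power_mult_distrib)
  have woven_bounds: "frame_with_bounds ip I (\<lambda>i. if i \<in> \<sigma> then \<phi> i else T (\<phi> i))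
      ((sqrt A - q * sqrt B)\<^sup>2) ((sqrt B + q * sqrt B)\<^sup>2)" for \<sigma>
  proof (rule frame_perturbation[OF assms(3) _ _ small])
    fix F x
    assume F: "finite F" "F \<subseteq> I"
    have "norm (ip x ((if i \<in> \<sigma> then \<phi> i else T (\<phi> i)) - \<phi> i)) \<le> norm (ip x (S (\<phi> i)))" for i
      using ip_minus_right[of x "S (\<phi> i)"] by (simp add: S_def)
    then have "L2_set (\<lambda>i. norm (ip x ((if i \<in> \<sigma> then \<phi> i else T (\<phi> i)) - \<phi> i))) F
        \<le> L2_set (\<lambda>i. norm (ip x (S (\<phi> i)))) F"
      by (intro L2_set_mono) simp_all
    also have "\<dots> \<le> q * sqrt B * norm x"
      using AB by (intro bessel_image[OF bessel[OF F] _ S_linear S_bound q]) simp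
    finally show "L2_set (\<lambda>i. norm (ip x ((if i \<in> \<sigma> then \<phi> i else T (\<phi> i)) - \<phi> i))) F
        \<le> q * sqrt B * norm x" .
  qed (use q AB in simp)
  have "is_frame ip I (\<lambda>i. T (\<phi> i))"
    using woven_bounds[of "{}"] by (auto simp: is_frame_def)
  then show ?thesis
    using assms(3) woven_bounds unfolding woven_def is_frame_def by blast
qed

end
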